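(* Let $d\ge1$ and let $\mathbf{r}=(r_0,\ldots,r_{d-1})\in\mathrm{int}(\mathcal{D}_d)$ be reduced, i.e. $r_0\ne0$. The family of SRS tiles $\{\mathcal{T}_\mathbf{r}(\mathbf{x})\mid\mathbf{x}\in\mathbb{Z}^d\}$ is a covering of $\mathbb{R}^d$, i.e., $$\bigcup_{\mathbf{x}\in\mathbb{Z}^d}\mathcal{T}_\mathbf{r}(\mathbf{x})=\mathbb{R}^d.$$
   Context: For $\mathbf{r}=(r_0,\ldots,r_{d-1})\in\mathbb{R}^d$ and $\mathbf{z}=(z_0,\ldots,z_{d-1})^t\in\mathbb{Z}^d$ put $\mathbf{r}\mathbf{z}=\sum_i r_iz_i$ and $\tau_\mathbf{r}(\mathbf{z})=(z_1,\ldots,z_{d-1},-\lfloor\mathbf{r}\mathbf{z}\rfloor)^t$, a map $\mathbb{Z}^d\to\mathbb{Z}^d$; $\tau_\mathbf{r}^{-n}(\mathbf{x})=\{\mathbf{z}\in\mathbb{Z}^d\mid\tau_\mathbf{r}^n(\mathbf{z})=\mathbf{x}\}$. $\mathcal{D}_d$ is the set of $\mathbf{r}\in\mathbb{R}^d$ such that $(\tau_\mathbf{r}^n(\mathbf{z}))_{n}$ is eventually periodic for all $\mathbf{z}\in\mathbb{Z}^d$. The companion matrix $M_\mathbf{r}\in\mathbb{R}^{d\times d}$ has last row $(-r_0,\ldots,-r_{d-1})$, entries $1$ on the superdiagonal of the first $d-1$ rows, and $0$ elsewhere (for $d=1$, $M_\mathbf{r}=(-r_0)$). It is a known fact that $\mathbf{r}\in\mathrm{int}(\mathcal{D}_d)$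 if and only if $M_\mathbf{r}$ has spectral radius $<1$. The SRS tile of $\mathbf{x}\in\mathbb{Z}^d$ is $\mathcal{T}_\mathbf{r}(\mathbf{x})=\mathrm{Li}_{n\to\infty}M_\mathbf{r}^n\tau_\mathbf{r}^{-n}(\mathbf{x})$, where the lower Hausdorff limit $\mathrm{Li}_{n\to\infty}A_n$ is the set of all $\mathbf{t}\in\mathbb{R}^d$ such that each neighbourhood of $\mathbf{t}$ intersects $A_n$ for all sufficiently large $n$. *)

theory Defs
  imports "HOL-Analysis.Analysis"
begin

text \<open>The coordinates of a vector in d-space are indexed by an arbitrary finite linearly ordered
  type of cardinality d; its elements, in increasing order, play the roles of the indices
  0, ..., d - 1. Types are nonempty, so d \<ge> 1, and every d \<ge> 1 occurs (for instance as a
  numeral type).\<close>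

definition first_ix :: "'n::{finite,linorder}" where
  "first_ix = Min UNIV"

definition last_ix :: "'n::{finite,linorder}" where
  "last_ix = Max UNIV"

text \<open>Only meaningful for indices below the last one.\<close>

definition next_ix :: "'n::{finite,linorder} \<Rightarrow> 'n::{finite,linorder}" where
  "next_ix i = Min {i<..}"

definition real_vec :: "int^'n \<Rightarrow> real^'n" where
  "real_vec z = (\<chi> i. real_of_int (z $ i))"

definition srs_map ::
  "real^'n::{finite,linorder} \<Rightarrow> int^'n::{finite,linorder} \<Rightarrow> int^'n::{finite,linorder}" where
  "srs_map r z = (\<chi> i. if i = last_ix then - \<lfloor>r \<bullet> real_vec z\<rfloor> else z $ next_ix i)"

definition srs_preimage ::
  "real^'n::{finite,linorder} \<Rightarrow> nat \<Rightarrow> int^'n::{finite,linorder} \<Rightarrow> (int^'n::{finite,linorder}) set" where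
  "srs_preimage r n x = {z. (srs_map r ^^ n) z = x}"

definition eventually_periodic :: "(nat \<Rightarrow> 'a) \<Rightarrow> bool" where
  "eventually_periodic s \<longleftrightarrow> (\<exists>N p. p > 0 \<and> (\<forall>n\<ge>N. s (n + p) = s n))"

definition srs_D :: "(real^'n::{finite,linorder}) set" where
  "srs_D = {r. \<forall>z. eventually_periodic (\<lambda>n. (srs_map r ^^ n) z)}"

definition companion_matrix ::
  "real^'n::{finite,linorder} \<Rightarrow> (real^'n::{finite,linorder})^'n::{finite,linorder}" where
  "companion_matrix r =
    (\<chi> i j. if i = last_ix then - (r $ j) else if j = next_ix i then 1 else 0)"

text \<open>The generic power operator on matrices, where available, is the entrywise power, not the
  power with respect to the matrix product.\<close>

primrec matrix_power :: "real^'n^'n \<Rightarrow> nat \<Rightarrow> real^'n^'n" where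
  "matrix_power A 0 = mat 1"
| "matrix_power A (Suc n) = A ** matrix_power A n"

definition lower_limit ::
  "(nat \<Rightarrow> 'a::topological_space set) \<Rightarrow> 'a set" where
  "lower_limit A = {t. \<forall>U. open U \<longrightarrow> t \<in> U \<longrightarrow> (\<forall>\<^sub>F n in sequentially. U \<inter> A n \<noteq> {})}"

definition srs_tile ::
  "real^'n::{finite,linorder} \<Rightarrow> int^'n::{finite,linorder} \<Rightarrow> (real^'n::{finite,linorder}) set" where
  "srs_tile r x =
    lower_limit (\<lambda>n. (\<lambda>z. matrix_power (companion_matrix r) n *v real_vec z) ` srs_preimage r n x)"

end

(* Multiplying r_i by c^(d-i), for c > 1 near 1, stays in D_d and multiplies the roots of
   the characteristic polynomial chi by c. A root l of modulus > 1 is impossible in D_d, so all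
   roots of chi have modulus < 1; hence M^n v is summable for all v, |r_0| <= 1 and tau is onto.
   Covering: given t, round M^(-n) t to an integer vector z_n. The vectors tau^n z_n are bounded,
   so some x equals tau^n z_n infinitely often. As tau is M up to an error [0,1) e_d,
   a preimage y of z satisfies |M^(n+1) y - M^n z| <= |M^n e_d|, so iterated preimages of such a z_n
   give points of M^m tau^(-m) x close to t for all m >= n. *)

theory Submission
  imports Defs "HOL-Computational_Algebra.Fundamental_Theorem_Algebra"
begin

section \<open>Linear recurrences\<close>

text \<open>With E the shift operator on sequences, this is p(E) a at \<open>n\<close>. Products of
  polynomials become compositions of operators, so a factorisation of \<open>p\<close> breaks a
  recurrence into steps of first order.\<close>

definition recur :: "complex poly \<Rightarrow> (nat \<Rightarrow> complex) \<Rightarrow> nat \<Rightarrow> complex" where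
  "recur p a n = (\<Sum>k\<le>degree p. coeff p k * a (n + k))"

lemma recur_altdef:
  assumes "degree p \<le> N"
  shows "recur p a n = (\<Sum>k\<le>N. coeff p k * a (n + k))"
  unfolding recur_def
  by (rule sum.mono_neutral_left) (use assms in \<open>auto simp: coeff_eq_0\<close>)

lemma recur_add: "recur (p + q) a n = recur p a n + recur q a n"
proof -
  let ?N = "max (degree p) (degree q)"
  have "recur (p + q) a n = (\<Sum>k\<le>?N. coeff (p + q) k * a (n + k))"
    by (rule recur_altdef) (simp add: degree_add_le_max)
  also have "\<dots> = (\<Sum>k\<le>?N. coeff p k * a (n + k)) + (\<Sum>k\<le>?N. coeff q k * a (n + k))"
    by (simp add: ring_distribs sum.distrib)
  also have "\<dots> = recur p a n + recur q a n"
    by (simp add: recur_altdef[where N = ?N])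
  finally show ?thesis .
qed

lemma recur_0 [simp]: "recur 0 a n = 0"
  by (simp add: recur_def)

lemma recur_sum: "recur (\<Sum>i\<in>A. f i) a n = (\<Sum>i\<in>A. recur (f i) a n)"
  by (induction A rule: infinite_finite_induct) (simp_all add: recur_add)

lemma recur_monom: "recur (monom c k) a n = c * a (n + k)"
proof -
  have "recur (monom c k) a n = (\<Sum>j\<le>k. coeff (monom c k) j * a (n + j))"
    by (rule recur_altdef) (rule degree_monom_le)
  also have "\<dots> = (\<Sum>j\<le>k. if j = k then c * a (n + j) else 0)"
    by (rule sum.cong) auto
  finally show ?thesis by simp
qed

text \<open>The operator q(E) is followed by E - l, which turns a sequence b into b (n + 1) - l b
  n.\<close>

lemma recur_linear_factor:
  "recur ([:-l, 1:] * q) a n = recur q a (Suc n) - l * recur q a n"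
proof -
  let ?N = "degree q"
  have "recur ([:-l, 1:] * q) a n
      = (\<Sum>k\<le>Suc ?N. coeff ([:-l, 1:] * q) k * a (n + k))"
    by (rule recur_altdef) (use degree_mult_le[of "[:-l, 1:]" q] in auto)
  also have "\<dots> = (\<Sum>k\<le>Suc ?N. coeff (pCons 0 q) k * a (n + k))
      - l * (\<Sum>k\<le>Suc ?N. coeff q k * a (n + k))"
    by (simp add: ring_distribs sum_subtractf sum_distrib_left mult.assoc sum.distrib sum_negf
        del: sum.atMost_Suc)
  also have "(\<Sum>k\<le>Suc ?N. coeff (pCons 0 q) k * a (n + k)) = recur q a (Suc n)"
    by (simp add: sum.atMost_Suc_shift recur_def del: sum.atMost_Suc)
  also have "(\<Sum>k\<le>Suc ?N. coeff q k * a (n + k)) = recur q a n"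
    by (rule recur_altdef[symmetric]) simp
  finally show ?thesis .
qed

text \<open>The triangle inequality bounds a partial sum S of the norms by |f 0| + |l| S + G, where
  G is the sum of the error series. As |l| < 1, this can be solved for S, with a bound independent
  of the number of terms.\<close>

lemma summable_norm_linear_recurrence:
  fixes f :: "nat \<Rightarrow> complex"
  assumes l: "norm l < 1" and g: "summable (\<lambda>n. norm (f (Suc n) - l * f n))"
  shows "summable (\<lambda>n. norm (f n))"
proof (rule summableI_nonneg_bounded)
  fix N
  let ?G = "\<Sum>n. norm (f (Suc n) - l * f n)"
  let ?S = "\<Sum>n<N. norm (f n)"
  have step: "norm (f (Suc n)) \<le> norm l * norm (f n) + norm (f (Suc n) - l * f n)" for n
    using norm_triangle_ineq[of "l * f n" "f (Suc n) - l * f n"] by (simp add: norm_mult)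
  have "?S \<le> (\<Sum>n<Suc N. norm (f n))" by simp
  also have "\<dots> = norm (f 0) + (\<Sum>n<N. norm (f (Suc n)))"
    by (simp add: sum.lessThan_Suc_shift del: sum.lessThan_Suc)
  also have "\<dots> \<le> norm (f 0) + (\<Sum>n<N. norm l * norm (f n) + norm (f (Suc n) - l * f n))"
    by (intro add_left_mono sum_mono step)
  also have "\<dots> = norm (f 0) + (norm l * ?S + (\<Sum>n<N. norm (f (Suc n) - l * f n)))"
    by (simp add: sum.distrib sum_distrib_left)
  also have "\<dots> \<le> norm (f 0) + (norm l * ?S + ?G)"
    using sum_le_suminf[OF g, of "{..<N}"] by simp
  finally have "(1 - norm l) * ?S \<le> norm (f 0) + ?G"
    by (simp add: algebra_simps)
  then show "?S \<le> (norm (f 0) + ?G) / (1 - norm l)"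
    using l by (simp add: field_simps)
qed simp

lemma poly_obtain_root_factor:
  fixes p :: "complex poly"
  assumes "degree p \<noteq> 0"
  obtains l q where "p = [:-l, 1:] * q" "poly p l = 0" "degree p = Suc (degree q)"
    "lead_coeff p = lead_coeff q"
proof -
  have "\<not> constant (poly p)" using assms by (simp add: constant_degree)
  then obtain l where l: "poly p l = 0" using fundamental_theorem_of_algebra by blast
  then obtain q where q: "p = [:-l, 1:] * q" by (auto simp: poly_eq_0_iff_dvd)
  have "q \<noteq> 0" using assms q by auto
  then have "degree p = Suc (degree q)" unfolding q by (subst degree_mult_eq) auto
  moreover have "lead_coeff p = lead_coeff q" unfolding q by (subst lead_coeff_mult) simp
  ultimately show thesis using that l q by blast
qed

text \<open>Roots are split off one by one: q(E) a satisfies a first-order recurrence with factor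
  \<open>l\<close> and summable error. Asking for a summable rather than a vanishing
  \<open>recur p a\<close> is what lets the induction pass from \<open>p\<close> to
  \<open>q\<close>.\<close>

lemma summable_norm_recur:
  assumes "\<And>l. poly p l = 0 \<Longrightarrow> norm l < 1"
    and "summable (\<lambda>n. norm (recur p a n))"
  shows "summable (\<lambda>n. norm (a n))"
  using assms
proof (induction "degree p" arbitrary: p)
  case 0
  then obtain c where p: "p = [:c:]" by (metis degree_eq_zeroE)
  \<comment> \<open>The zero polynomial would have the root 1, whose norm is not below 1.\<close>
  have "c \<noteq> 0" using "0.prems"(1)[of 1] p by auto
  then show ?case using "0.prems"(2) by (simp add: p recur_def norm_mult summable_cmult_iff)
next
  case (Suc d)
  from Suc.hyps(2) have "degree p \<noteq> 0" by simp
  then obtain l q where q: "p = [:-l, 1:] * q" "poly p l = 0" "degree p = Suc (degree q)"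
    by (rule poly_obtain_root_factor)
  have "summable (\<lambda>n. norm (recur q a n))"
  proof (rule summable_norm_linear_recurrence)
    show "norm l < 1" by (rule Suc.prems(1)) fact
    show "summable (\<lambda>n. norm (recur q a (Suc n) - l * recur q a n))"
      using Suc.prems(2) unfolding q(1) recur_linear_factor .
  qed
  moreover have "norm k < 1" if "poly q k = 0" for k
    by (rule Suc.prems(1)) (simp add: q(1) that)
  ultimately show ?case using Suc.hyps q(3) by auto
qed

text \<open>By Vieta, the constant coefficient is, up to sign, the leading coefficient times the
  product of the roots. For the companion polynomial this will bound |r_0| by 1.\<close>

lemma norm_coeff_0_le:
  fixes p :: "complex poly"
  assumes "\<And>l. poly p l = 0 \<Longrightarrow> norm l \<le> 1"
  shows "norm (coeff p 0) \<le> norm (lead_coeff p)"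
  using assms
proof (induction "degree p" arbitrary: p)
  case (Suc d)
  from Suc.hyps(2) have "degree p \<noteq> 0" by simp
  then obtain l q where q: "p = [:-l, 1:] * q" "poly p l = 0" "degree p = Suc (degree q)"
    "lead_coeff p = lead_coeff q"
    by (rule poly_obtain_root_factor)
  have "norm k \<le> 1" if "poly q k = 0" for k
    by (rule Suc.prems(1)) (simp add: q(1) that)
  then have IH: "norm (coeff q 0) \<le> norm (lead_coeff q)"
    using Suc.hyps q(3) by auto
  have "norm (coeff p 0) = norm l * norm (coeff q 0)" by (simp add: q(1) norm_mult)
  also have "\<dots> \<le> norm (coeff q 0)"
    using Suc.prems[OF q(2)] by (simp add: mult_left_le_one_le)
  finally show ?case using IH q(4) by simp
qed auto

text \<open>K = 1 / (|l| - 1) is the fixed point of x -> |l| x - 1. An excess of |b n| over K grows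
  at least by the factor |l| in each step, so a positive excess at 0 contradicts
  boundedness.\<close>

lemma bounded_expanding_recurrence:
  fixes b :: "nat \<Rightarrow> complex"
  assumes l: "norm l > 1" and b: "\<And>n. norm (b n) \<le> B"
    and step: "\<And>n. norm (b (Suc n) - l * b n) \<le> 1"
  shows "norm (b 0) \<le> 1 / (norm l - 1)"
proof (rule ccontr)
  let ?K = "1 / (norm l - 1)"
  assume "\<not> ?thesis"
  then have pos: "norm (b 0) - ?K > 0" by simp
  have K: "norm l * ?K = ?K + 1" using l by (simp add: field_simps)
  have grow: "norm l ^ n * (norm (b 0) - ?K) \<le> norm (b n) - ?K" for n
  proof (induction n)
    case (Suc n)
    have "norm l ^ Suc n * (norm (b 0) - ?K) \<le> norm l * (norm (b n) - ?K)"
      using mult_left_mono[OF Suc, of "norm l"] by (simp add: mult.assoc)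
    also have "\<dots> = norm (l * b n) - 1 - ?K"
      using K by (simp add: right_diff_distrib norm_mult)
    also have "\<dots> \<le> norm (b (Suc n)) - ?K"
      using step[of n] norm_triangle_ineq3[of "l * b n" "b (Suc n)"]
      by (simp add: norm_minus_commute)
    finally show ?case .
  qed simp
  obtain n where "(B - ?K) / (norm (b 0) - ?K) < norm l ^ n"
    using real_arch_pow[OF l] by blast
  then have "B - ?K < norm l ^ n * (norm (b 0) - ?K)"
    using pos by (simp add: pos_divide_less_eq)
  with grow[of n] b[of n] show False by linarith
qed

section \<open>The enumeration of the indices\<close>

definition prev_ix :: "'n::{finite,linorder} \<Rightarrow> 'n" where
  "prev_ix i = Max {..<i}"

text \<open>Translates an abstract index into its number in 0, ..., d - 1, to be used as an exponent
  and as a time shift.\<close>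

definition ix_rank :: "'n::{finite,linorder} \<Rightarrow> nat" where
  "ix_rank i = card {..<i}"

lemma first_ix_le: "first_ix \<le> i"
  by (simp add: first_ix_def)

lemma le_last_ix: "i \<le> last_ix"
  by (simp add: last_ix_def)

lemma next_ix_eqI:
  assumes "i < j" "\<And>k. i < k \<Longrightarrow> j \<le> k"
  shows "next_ix i = j"
  unfolding next_ix_def by (rule Min_eqI) (use assms in auto)

lemma less_last_ix: "i \<noteq> last_ix \<Longrightarrow> i < last_ix"
  using le_last_ix[of i] by simp

lemma first_ix_less: "i \<noteq> first_ix \<Longrightarrow> first_ix < i"
  using first_ix_le[of i] by simp

lemma next_ix_greater:
  assumes "i \<noteq> last_ix"
  shows "i < next_ix i" and "i < k \<Longrightarrow> next_ix i \<le> k"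
proof -
  have "{i<..} \<noteq> {}" using less_last_ix[OF assms] by auto
  then have "next_ix i \<in> {i<..}" unfolding next_ix_def by (intro Min_in) auto
  then show "i < next_ix i" by simp
  show "next_ix i \<le> k" if "i < k" using that unfolding next_ix_def by (intro Min_le) auto
qed

lemma prev_ix_less:
  assumes "i \<noteq> first_ix"
  shows "prev_ix i < i" and "k < i \<Longrightarrow> k \<le> prev_ix i"
proof -
  have "{..<i} \<noteq> {}" using first_ix_less[OF assms] by auto
  then have "prev_ix i \<in> {..<i}" unfolding prev_ix_def by (intro Max_in) auto
  then show "prev_ix i < i" by simp
  show "k \<le> prev_ix i" if "k < i" using that unfolding prev_ix_def by (intro Max_ge) auto
qed

lemma prev_ix_neq_last: "i \<noteq> first_ix \<Longrightarrow> prev_ix i \<noteq> last_ix"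
  using prev_ix_less(1)[of i] le_last_ix[of i] by auto

lemma next_ix_neq_first: "i \<noteq> last_ix \<Longrightarrow> next_ix i \<noteq> first_ix"
  using next_ix_greater(1)[of i] first_ix_le[of i] by auto

lemma next_prev_ix:
  assumes "i \<noteq> first_ix"
  shows "next_ix (prev_ix i) = i"
  by (rule next_ix_eqI) (use prev_ix_less[OF assms] in \<open>auto simp: not_less[symmetric]\<close>)

lemma prev_next_ix:
  assumes "i \<noteq> last_ix"
  shows "prev_ix (next_ix i) = i"
  using next_ix_greater[OF assms] prev_ix_less[OF next_ix_neq_first[OF assms]]
  by (metis leD order.antisym not_le)

lemma ix_rank_less: "ix_rank (i :: 'n::{finite,linorder}) < CARD('n)"
  unfolding ix_rank_def by (rule psubset_card_mono) auto

lemma ix_rank_mono: "i < j \<Longrightarrow> ix_rank i < ix_rank j"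
  unfolding ix_rank_def by (rule psubset_card_mono) auto

lemma inj_ix_rank: "inj ix_rank"
  by (rule injI) (metis ix_rank_mono neq_iff)

lemma bij_betw_ix_rank: "bij_betw (ix_rank :: 'n \<Rightarrow> nat) UNIV {..<CARD('n::{finite,linorder})}"
proof -
  have "(ix_rank :: 'n \<Rightarrow> nat) ` UNIV = {..<CARD('n)}"
    by (rule card_subset_eq) (auto simp: ix_rank_less card_image inj_ix_rank)
  then show ?thesis by (simp add: bij_betw_def inj_ix_rank)
qed

lemma ix_rank_first [simp]: "ix_rank first_ix = 0"
  by (simp add: ix_rank_def lessThan_def first_ix_le[THEN leD])

lemma ix_rank_eq_0_iff: "ix_rank i = 0 \<longleftrightarrow> i = first_ix"
  by (metis inj_ix_rank injD ix_rank_first)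

lemma ix_rank_last: "Suc (ix_rank (last_ix :: 'n)) = CARD('n::{finite,linorder})"
proof -
  have "(UNIV :: 'n set) = insert last_ix {..<last_ix}"
    using less_last_ix by auto
  then have "CARD('n) = card (insert (last_ix :: 'n) {..<last_ix})" by simp
  then show ?thesis by (simp add: ix_rank_def)
qed

lemma ix_rank_prev_ix:
  assumes "i \<noteq> first_ix"
  shows "ix_rank i = Suc (ix_rank (prev_ix i))"
proof -
  have "{..<i} = insert (prev_ix i) {..<prev_ix i}"
    using prev_ix_less[OF assms] by force
  then show ?thesis by (simp add: ix_rank_def)
qed

text \<open>Every step moves the coordinates one place towards the first, so the entry at
  \<open>i\<close> arrives there after \<open>ix_rank i\<close> steps. Orbits of both the companion
  matrix and the integer map are thus encoded by the scalar sequence of their first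
  coordinates.\<close>

lemma shift_orbit_nth:
  assumes "\<And>n j. j \<noteq> last_ix \<Longrightarrow> u (Suc n) $ j = u n $ next_ix j"
  shows "u n $ i = u (n + ix_rank i) $ first_ix"
proof (induction "ix_rank i" arbitrary: i n)
  case 0
  then show ?case by (simp add: ix_rank_eq_0_iff)
next
  case (Suc k)
  then have i: "i \<noteq> first_ix" by auto
  have "u n $ i = u (Suc n) $ prev_ix i"
    using assms[OF prev_ix_neq_last[OF i]] by (simp add: next_prev_ix i)
  also have "\<dots> = u (Suc n + ix_rank (prev_ix i)) $ first_ix"
    using Suc.hyps ix_rank_prev_ix[OF i] by simp
  finally show ?case by (simp add: ix_rank_prev_ix i)
qed

section \<open>The companion polynomial\<close>

text \<open>The characteristic polynomial X^d + r_(d-1) X^(d-1) + ... + r_0 of the companion matrix,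
  taken over the complex numbers so that it splits.\<close>

definition companion_poly :: "real^'n::{finite,linorder} \<Rightarrow> complex poly" where
  "companion_poly r =
     monom 1 (CARD('n)) + (\<Sum>i\<in>UNIV. monom (of_real (r $ i)) (ix_rank i))"

lemma recur_companion_poly:
  fixes r :: "real^'n::{finite,linorder}"
  shows "recur (companion_poly r) a n =
    a (n + CARD('n)) + (\<Sum>i\<in>UNIV. of_real (r $ i) * a (n + ix_rank i))"
  by (simp add: companion_poly_def recur_add recur_sum recur_monom)

lemma poly_companion_poly:
  fixes r :: "real^'n::{finite,linorder}"
  shows "poly (companion_poly r) l = l ^ CARD('n) + (\<Sum>i\<in>UNIV. of_real (r $ i) * l ^ ix_rank i)"
  by (simp add: companion_poly_def poly_monom poly_sum)

lemma degree_companion_poly: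
  fixes r :: "real^'n::{finite,linorder}"
  shows "degree (companion_poly r) = CARD('n)" and "lead_coeff (companion_poly r) = 1"
proof -
  have less: "degree (\<Sum>i\<in>UNIV. monom (complex_of_real (r $ i)) (ix_rank i)) < CARD('n)"
    by (rule degree_sum_less)
       (auto intro: le_less_trans[OF degree_monom_le ix_rank_less])
  then show deg: "degree (companion_poly r) = CARD('n)"
    unfolding companion_poly_def by (subst degree_add_eq_left) (simp_all add: degree_monom_eq)
  show "lead_coeff (companion_poly r) = 1"
    unfolding deg using less by (simp add: companion_poly_def coeff_eq_0)
qed

lemma coeff_0_companion_poly: "coeff (companion_poly r) 0 = of_real (r $ first_ix)"
  by (simp add: companion_poly_def coeff_sum ix_rank_eq_0_iff if_distrib cong: if_cong)

lemma companion_matrix_nth: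
  "(companion_matrix r *v v) $ i = (if i = last_ix then - (r \<bullet> v) else v $ next_ix i)"
proof (cases "i = last_ix")
  case True
  then show ?thesis
    by (simp add: companion_matrix_def matrix_vector_mult_def inner_vec_def sum_negf)
next
  case False
  then show ?thesis
    by (simp add: companion_matrix_def matrix_vector_mult_def if_distrib[of "\<lambda>x. x * _"]
        cong: if_cong)
qed

lemma srs_map_nth:
  "srs_map r z $ i = (if i = last_ix then - \<lfloor>r \<bullet> real_vec z\<rfloor> else z $ next_ix i)"
  by (simp add: srs_map_def)

text \<open>The first coordinates of the orbit satisfy the homogeneous recurrence of the companion
  polynomial and are therefore absolutely summable; all other coordinates are shifts of this
  sequence.\<close>

lemma summable_companion_orbit:
  fixes r :: "real^'n::{finite,linorder}"
  assumes "\<And>l. poly (companion_poly r) l = 0 \<Longrightarrow> norm l < 1"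
  shows "summable (\<lambda>n. norm (matrix_power (companion_matrix r) n *v v))"
proof -
  define u where "u n = matrix_power (companion_matrix r) n *v v" for n
  define s where "s n = u n $ first_ix" for n
  have u_Suc: "u (Suc n) = companion_matrix r *v u n" for n
    by (simp add: u_def matrix_vector_mul_assoc)
  have u_nth: "u n $ i = s (n + ix_rank i)" for n i
    unfolding s_def by (rule shift_orbit_nth) (simp add: u_Suc companion_matrix_nth)
  have s_rec: "s (n + CARD('n)) + (\<Sum>i\<in>UNIV. r $ i * s (n + ix_rank i)) = 0" for n
  proof -
    have "s (n + CARD('n)) = u (Suc n) $ last_ix"
      unfolding u_nth by (simp flip: ix_rank_last)
    also have "\<dots> = - (\<Sum>i\<in>UNIV. r $ i * s (n + ix_rank i))"
      by (simp add: u_Suc companion_matrix_nth inner_vec_def u_nth)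
    finally show ?thesis by simp
  qed
  have "recur (companion_poly r) (\<lambda>n. of_real (s n)) n = of_real 0" for n
    unfolding recur_companion_poly s_rec[of n, symmetric] by simp
  then have "summable (\<lambda>n. norm (complex_of_real (s n)))"
    by - (rule summable_norm_recur[where p = "companion_poly r"], simp_all add: assms)
  then have s: "summable (\<lambda>n. \<bar>s n\<bar>)" by simp
  have "summable (\<lambda>n. \<Sum>i\<in>UNIV. \<bar>u n $ i\<bar>)"
    unfolding u_nth by (rule summable_sum) (rule summable_ignore_initial_segment[OF s])
  then show ?thesis
    unfolding u_def[symmetric]
    by (rule summable_comparison_test'[where N = 0]) (simp add: norm_le_l1_cart)
qed

section \<open>Roots of the companion polynomial\<close>

lemma eventually_periodic_finite_range:
  assumes "eventually_periodic s"
  shows "finite (range s)"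
proof -
  obtain N p where p: "p > 0" "\<And>n. n \<ge> N \<Longrightarrow> s (n + p) = s n"
    using assms by (auto simp: eventually_periodic_def)
  have "s n \<in> s ` {..<N + p}" for n
  proof (induction n rule: less_induct)
    case (less n)
    show ?case
    proof (cases "n < N + p")
      case False
      then have "s n = s (n - p)" using p(2)[of "n - p"] by simp
      then show ?thesis using less[of "n - p"] p(1) False by simp
    qed simp
  qed
  then have "range s \<subseteq> s ` {..<N + p}" by blast
  then show ?thesis by (rule finite_subset) simp
qed

text \<open>If \<open>\<chi> = (X - l) q\<close>, then applying \<open>q\<close> to an integer orbit gives a bounded sequence that is
  multiplied by \<open>l\<close> up to an error below 1 in each step. For \<open>|l| > 1\<close> such a sequence
  has a bounded initial term, whereas the initial term is arbitrarily large on multiples of a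
  unit vector.\<close>

lemma srs_D_root_le_1:
  fixes r :: "real^'n::{finite,linorder}"
  assumes r: "r \<in> srs_D" and root: "poly (companion_poly r) l = 0"
  shows "norm l \<le> 1"
proof (rule ccontr)
  assume "\<not> norm l \<le> 1"
  then have l: "norm l > 1" by simp
  obtain q where q: "companion_poly r = [:-l, 1:] * q"
    using root by (auto simp: poly_eq_0_iff_dvd)
  have "q \<noteq> 0"
    using degree_companion_poly[of r] q by auto
  then have "degree (companion_poly r) = Suc (degree q)"
    unfolding q by (subst degree_mult_eq) auto
  then have deg: "degree q = ix_rank (last_ix :: 'n)"
    using ix_rank_last[where 'n = 'n] degree_companion_poly[of r] by simp
  \<comment> \<open>So \<open>q\<close> is monic of degree d - 1, and its top coefficient meets the
    last coordinate of the starting vector.\<close>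
  have lc: "coeff q (ix_rank (last_ix :: 'n)) = 1"
    using degree_companion_poly(2)[of r] unfolding q lead_coeff_mult by (simp flip: deg)
  obtain N :: nat where N: "real N > 1 / (norm l - 1)"
    using reals_Archimedean2 by blast
  \<comment> \<open>In this multiple of the last unit vector only the leading coefficient of
    \<open>q\<close> sees a nonzero entry, which makes b 0 equal to \<open>N\<close>.\<close>
  define z :: "int^'n::{finite,linorder}" where "z = (\<chi> i. if i = last_ix then int N else 0)"
  define u where "u n = (srs_map r ^^ n) z" for n
  define s where "s n = u n $ first_ix" for n
  have u_Suc: "u (Suc n) = srs_map r (u n)" for n by (simp add: u_def)
  have u_nth: "u n $ i = s (n + ix_rank i)" for n i
    unfolding s_def by (rule shift_orbit_nth) (simp add: u_Suc srs_map_nth)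
  have "finite (range u)"
    unfolding u_def using r by (intro eventually_periodic_finite_range) (simp add: srs_D_def)
  then have "finite ((\<lambda>v. v $ first_ix) ` range u)" by simp
  then have "finite (range s)" by (simp add: s_def image_image)
  then have fin: "finite ((\<lambda>k. \<bar>real_of_int k\<bar>) ` range s)" by simp
  define S where "S = Max ((\<lambda>k. \<bar>real_of_int k\<bar>) ` range s)"
  have S: "\<bar>real_of_int (s n)\<bar> \<le> S" for n
    unfolding S_def by (rule Max_ge[OF fin]) simp
  define b where "b = recur q (\<lambda>n. of_int (s n))"
  have "norm (b n) \<le> (\<Sum>k\<le>degree q. norm (coeff q k) * S)" for n
    unfolding b_def recur_def
    by (rule sum_norm_le) (auto simp: norm_mult intro!: mult_left_mono S)
  moreover have "norm (b (Suc n) - l * b n) \<le> 1" for n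
  proof -
    let ?x = "r \<bullet> real_vec (u n)"
    have "s (n + CARD('n)) = u (Suc n) $ last_ix"
      unfolding u_nth by (simp flip: ix_rank_last)
    also have "\<dots> = - \<lfloor>?x\<rfloor>" by (simp add: u_Suc srs_map_nth)
    finally have 1: "s (n + CARD('n)) = - \<lfloor>?x\<rfloor>" .
    have 2: "?x = (\<Sum>i\<in>UNIV. r $ i * s (n + ix_rank i))"
      by (simp add: inner_vec_def real_vec_def u_nth)
    have "b (Suc n) - l * b n = recur (companion_poly r) (\<lambda>n. of_int (s n)) n"
      unfolding b_def q by (rule recur_linear_factor[symmetric])
    \<comment> \<open>The new entry is minus the floor of \<open>?x\<close>, whereas the remaining
      terms of the recurrence add up to \<open>?x\<close> itself.\<close>
    also have "\<dots> = of_real (frac ?x)"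
      unfolding recur_companion_poly 1 frac_def by (simp add: 2)
    finally show ?thesis
      using frac_lt_1[of ?x] frac_ge_0[of ?x] by simp
  qed
  ultimately have "norm (b 0) \<le> 1 / (norm l - 1)"
    by (rule bounded_expanding_recurrence[OF l])
  moreover have "b 0 = of_nat N"
  proof -
    have "s (ix_rank i) = z $ i" for i
      using u_nth[of 0 i] by (simp add: u_def)
    then have s_z: "s (ix_rank i) = (if i = last_ix then int N else 0)" for i :: 'n
      by (simp add: z_def)
    have "{..degree q} = {..<CARD('n)}"
      using ix_rank_last[where 'n = 'n] by (auto simp: deg)
    then have "b 0 = (\<Sum>k<CARD('n). coeff q k * of_int (s k))"
      by (simp add: b_def recur_def)
    also have "\<dots> = (\<Sum>i\<in>(UNIV :: 'n set). coeff q (ix_rank i) * of_int (s (ix_rank i)))"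
      by (rule sum.reindex_bij_betw[OF bij_betw_ix_rank, symmetric])
    also have "\<dots> = (\<Sum>i\<in>UNIV. if i = (last_ix :: 'n) then of_nat N else 0)"
      by (rule sum.cong) (auto simp: s_z lc)
    finally show ?thesis by simp
  qed
  ultimately show False using N by simp
qed

text \<open>The weak bound becomes strict by applying it to a scaled parameter \<open>f c\<close>
  with the root c l: openness leaves room for some c > 1, and then c |l| \<le> 1.\<close>

lemma interior_srs_D_root_less_1:
  fixes r :: "real^'n::{finite,linorder}"
  assumes r: "r \<in> interior srs_D" and root: "poly (companion_poly r) l = 0"
  shows "norm l < 1"
proof -
  define f :: "real \<Rightarrow> real^'n::{finite,linorder}" where "f c = (\<chi> i. r $ i * c ^ (CARD('n) - ix_rank i))" for c
  have "isCont f 1"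
    unfolding f_def isCont_def by (intro vec_tendstoI) (auto intro!: tendsto_eq_intros)
  moreover have "f 1 = r" by (simp add: f_def)
  ultimately have "\<forall>\<^sub>F c in at 1. f c \<in> interior srs_D"
    using r by (metis isCont_def open_interior topological_tendstoD)
  then have "\<forall>\<^sub>F c in at_right 1. f c \<in> interior srs_D"
    by (rule filter_leD[OF at_le, rotated]) simp
  moreover have "\<forall>\<^sub>F c in at_right (1::real). c > 1"
    by (rule eventually_at_right_less)
  ultimately have "\<forall>\<^sub>F c in at_right 1. f c \<in> interior srs_D \<and> c > 1"
    by (rule eventually_conj)
  then obtain c where c: "f c \<in> interior srs_D" "c > 1"
    by (auto dest!: eventually_happens)
  \<comment> \<open>The weights are chosen for homogeneity: c^(d-i) from the coefficient and c^i
    from the argument combine to c^d in every term.\<close>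
  have "poly (companion_poly (f c)) (of_real c * l)
      = of_real c ^ CARD('n) * poly (companion_poly r) l"
  proof -
    have "complex_of_real c ^ (CARD('n) - ix_rank i) * of_real c ^ ix_rank i = of_real c ^ CARD('n)"
      for i :: 'n
      using ix_rank_less[of i] by (simp flip: power_add)
    then have "of_real (f c $ i) * (of_real c * l) ^ ix_rank i
        = of_real c ^ CARD('n) * (of_real (r $ i) * l ^ ix_rank i)" for i
      by (simp add: f_def power_mult_distrib mult_ac)
    then show ?thesis
      by (simp only: poly_companion_poly power_mult_distrib[of _ _ "CARD('n)"]
          distrib_left sum_distrib_left)
  qed
  then have "poly (companion_poly (f c)) (of_real c * l) = 0" using root by simp
  then have "norm (of_real c * l) \<le> 1"
    using srs_D_root_le_1 c(1) interior_subset by blast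
  then have "c * norm l \<le> 1" using c(2) by (simp add: norm_mult)
  moreover have "c * norm l \<ge> c" if "norm l \<ge> 1" using that c(2) by simp
  ultimately show ?thesis using c(2) by (meson not_le order.trans leD)
qed

section \<open>Surjectivity and distance estimates\<close>

lemma finite_real_vec_bounded: "finite {x :: int^'n::finite. norm (real_vec x) \<le> B}"
proof -
  let ?S = "{x :: int^'n. norm (real_vec x) \<le> B}"
  have "x $ i \<in> {\<lfloor>-B\<rfloor>..\<lceil>B\<rceil>}" if "norm (real_vec x) \<le> B" for x :: "int^'n" and i
  proof -
    have "\<bar>real_of_int (x $ i)\<bar> \<le> B"
      using component_le_norm_cart[of "real_vec x" i] that by (simp add: real_vec_def)
    then show ?thesis by (simp add: abs_le_iff) linarith
  qed
  then have "vec_nth ` ?S \<subseteq> PiE UNIV (\<lambda>_. {\<lfloor>-B\<rfloor>..\<lceil>B\<rceil>})" by auto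
  then have "finite (vec_nth ` ?S)" by (rule finite_subset) (simp add: finite_PiE)
  then show ?thesis by (rule finite_imageD) (simp add: inj_on_def vec_nth_inject)
qed

text \<open>The values a k + c form an arithmetic progression with gaps |a| \<le> 1, so one of them
  falls into [m, m + 1).\<close>

lemma exists_floor_affine:
  fixes a c :: real
  assumes "a \<noteq> 0" "\<bar>a\<bar> \<le> 1"
  shows "\<exists>k::int. \<lfloor>a * of_int k + c\<rfloor> = m"
proof (cases "a > 0")
  case True
  define k where "k = \<lceil>(m - c) / a\<rceil>"
  have "(m - c) / a \<le> k" "k < (m - c) / a + 1" unfolding k_def by linarith+
  then have "m - c \<le> a * k" "a * k < m - c + a" using True by (simp_all add: field_simps)
  then show ?thesis using assms True by (intro exI[of _ k]) (simp add: floor_eq_iff)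
next
  case False
  then have a: "a < 0" using assms by simp
  \<comment> \<open>As \<open>a\<close> is negative, the least value at or above \<open>m\<close>
    belongs to the largest admissible \<open>k\<close>, hence the floor in place of the
    ceiling.\<close>
  define k where "k = \<lfloor>(m - c) / a\<rfloor>"
  have "k \<le> (m - c) / a" "(m - c) / a < k + 1" unfolding k_def by linarith+
  then have "m - c \<le> a * k" "a * k < m - c - a" using a by (simp_all add: field_simps)
  then show ?thesis using assms a by (intro exI[of _ k]) (simp add: floor_eq_iff)
qed

text \<open>The shift prescribes every coordinate of a preimage except the first. That one is free
  and is chosen so that the floor takes the value required by the last coordinate of
  \<open>x\<close>.\<close>

lemma srs_map_surj:
  assumes "r $ first_ix \<noteq> 0" "\<bar>r $ first_ix\<bar> \<le> 1"
  shows "\<exists>y. srs_map r y = x"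
proof -
  define c where "c = (\<Sum>i\<in>UNIV - {first_ix}. r $ i * x $ prev_ix i)"
  obtain k where k: "\<lfloor>r $ first_ix * of_int k + c\<rfloor> = - (x $ last_ix)"
    using exists_floor_affine[OF assms] by blast
  define y where "y = (\<chi> i. if i = first_ix then k else x $ prev_ix i)"
  have "r \<bullet> real_vec y = r $ first_ix * k + c"
    unfolding inner_vec_def real_vec_def c_def
    by (subst sum.remove[of _ first_ix]) (auto simp: y_def intro!: sum.cong)
  then have "srs_map r y = x"
    using k by (simp add: vec_eq_iff srs_map_nth y_def next_ix_neq_first prev_next_ix)
  then show ?thesis by blast
qed

text \<open>The kernel is trivial: the shifting rows kill all coordinates but the first, and the
  last row then reads r_0 v_0 = 0.\<close>

lemma companion_matrix_surj:
  assumes "r $ first_ix \<noteq> 0"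
  shows "surj ((*v) (companion_matrix r))"
proof (rule linear_inj_imp_surj)
  show "inj ((*v) (companion_matrix r))"
  proof (subst linear_injective_0, simp, intro allI impI)
    fix v assume 0: "companion_matrix r *v v = 0"
    have v: "v $ i = 0" if "i \<noteq> first_ix" for i
      using arg_cong[OF 0, of "\<lambda>w. w $ prev_ix i"] that
      by (simp add: companion_matrix_nth prev_ix_neq_last next_prev_ix)
    have "r \<bullet> v = r $ first_ix * v $ first_ix"
      unfolding inner_vec_def by (subst sum.remove[of _ first_ix]) (auto simp: v)
    then have "v $ first_ix = 0"
      using arg_cong[OF 0, of "\<lambda>w. w $ last_ix"] assms by (simp add: companion_matrix_nth)
    with v show "v = 0" by (metis vec_eq_iff zero_index)
  qed
qed simp

text \<open>Provides the point that plays the role of M^(-n) t.\<close>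

lemma matrix_power_surj:
  assumes "surj ((*v) A)"
  shows "\<exists>v. matrix_power A n *v v = t"
proof (induction n arbitrary: t)
  case (Suc n)
  obtain w where "t = A *v w" using assms by (metis surjD)
  moreover obtain v where "matrix_power A n *v v = w" using Suc by blast
  ultimately show ?case by (auto simp flip: matrix_vector_mul_assoc)
qed simp

section \<open>The integer map compared with its linear part\<close>

lemma matrix_power_Suc_right: "matrix_power A (Suc n) = matrix_power A n ** A"
  by (induction n) (simp_all add: matrix_mul_assoc)

text \<open>Only the last coordinates differ, because - floor x = - x + frac x.\<close>

lemma real_vec_srs_map:
  "real_vec (srs_map r z) =
    companion_matrix r *v real_vec z + frac (r \<bullet> real_vec z) *\<^sub>R axis last_ix 1"
  by (simp add: vec_eq_iff companion_matrix_nth real_vec_def[of "srs_map r z"] srs_map_nth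
      frac_def axis_def) (simp add: real_vec_def)

lemma norm_matrix_power_srs_map_diff:
  "norm (matrix_power (companion_matrix r) (Suc n) *v real_vec y
      - matrix_power (companion_matrix r) n *v real_vec (srs_map r y))
    \<le> norm (matrix_power (companion_matrix r) n *v axis last_ix 1)"
proof -
  let ?P = "matrix_power (companion_matrix r) n"
  let ?f = "frac (r \<bullet> real_vec y)"
  have "matrix_power (companion_matrix r) (Suc n) *v real_vec y - ?P *v real_vec (srs_map r y)
      = - (?f *\<^sub>R (?P *v axis last_ix 1))"
    by (simp add: matrix_power_Suc_right real_vec_srs_map matrix_vector_right_distrib
        matrix_vector_mult_scaleR del: matrix_power.simps flip: matrix_vector_mul_assoc)
  also have "norm \<dots> \<le> norm (?P *v axis last_ix 1)"
    using frac_lt_1[of "r \<bullet> real_vec y"] frac_ge_0[of "r \<bullet> real_vec y"]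
    by (simp add: mult_left_le_one_le)
  finally show ?thesis .
qed

text \<open>Each application of the integer map replaces one factor M, and the replacement made
  while M^k still acts outside costs at most |M^k e_d|. With summable errors the bound is uniform in
  \<open>n\<close> as long as the M^n z stay bounded.\<close>

lemma norm_srs_orbit_le:
  "norm (real_vec ((srs_map r ^^ n) z)) \<le>
    norm (matrix_power (companion_matrix r) n *v real_vec z)
    + (\<Sum>k<n. norm (matrix_power (companion_matrix r) k *v axis last_ix 1))"
proof (induction n arbitrary: z)
  case (Suc n)
  let ?M = "matrix_power (companion_matrix r)"
  have "norm (?M n *v real_vec (srs_map r z)) \<le>
      norm (?M (Suc n) *v real_vec z) + norm (?M n *v axis last_ix 1)"
    using norm_matrix_power_srs_map_diff[of r n z]
      norm_triangle_ineq3[of "?M (Suc n) *v real_vec z" "?M n *v real_vec (srs_map r z)"]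
    by linarith
  then show ?case
    using Suc[of "srs_map r z"] by (simp add: funpow_swap1 del: matrix_power.simps)
qed simp

text \<open>Convergence on the finitely many unit vectors is uniform on bounded sets, so the vector
  may vary with \<open>n\<close>.\<close>

lemma matrix_power_mult_tendsto_0:
  fixes A :: "real^'n^'n"
  assumes "\<And>v. (\<lambda>n. matrix_power A n *v v) \<longlonglongrightarrow> 0" "\<And>n i. \<bar>u n $ i\<bar> \<le> B"
  shows "(\<lambda>n. matrix_power A n *v u n) \<longlonglongrightarrow> 0"
proof (rule Lim_null_comparison)
  let ?g = "\<lambda>n. \<Sum>i\<in>UNIV. B * norm (matrix_power A n *v axis i 1)"
  have "norm (matrix_power A n *v u n) \<le> ?g n" for n
  proof -
    have "matrix_power A n *v u n
        = matrix_power A n *v (\<Sum>i\<in>UNIV. u n $ i *\<^sub>R axis i 1)"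
      by (simp add: basis_expansion flip: scalar_mult_eq_scaleR)
    also have "\<dots> = (\<Sum>i\<in>UNIV. u n $ i *\<^sub>R (matrix_power A n *v axis i 1))"
      by (simp add: linear_sum[OF matrix_vector_mul_linear] matrix_vector_mult_scaleR)
    also have "norm \<dots> \<le> ?g n"
      by (rule sum_norm_le) (auto intro!: mult_right_mono assms(2))
    finally show ?thesis .
  qed
  then show "\<forall>\<^sub>F n in sequentially. norm (matrix_power A n *v u n) \<le> ?g n" by simp
  show "?g \<longlonglongrightarrow> 0"
    by (intro tendsto_null_sum tendsto_mult_right_zero tendsto_norm_zero assms(1))
qed

text \<open>Preimages are chosen one after another, and passing from level k to level k + 1 moves
  the renormalised point by at most |M^k e_d|. The total displacement is a block of a series that
  will be convergent.\<close>

lemma srs_preimage_extend: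
  assumes surj: "\<And>x. \<exists>y. srs_map r y = x" and "(srs_map r ^^ n) z = x" and "n \<le> m"
  shows "\<exists>y. (srs_map r ^^ m) y = x \<and>
    norm (matrix_power (companion_matrix r) m *v real_vec y
      - matrix_power (companion_matrix r) n *v real_vec z)
    \<le> (\<Sum>k=n..<m. norm (matrix_power (companion_matrix r) k *v axis last_ix 1))"
  using assms(3)
proof (induction m rule: dec_induct)
  case base
  then show ?case using assms(2) by auto
next
  case (step m)
  let ?M = "matrix_power (companion_matrix r)"
  obtain y where y: "(srs_map r ^^ m) y = x"
    "norm (?M m *v real_vec y - ?M n *v real_vec z)
      \<le> (\<Sum>k=n..<m. norm (?M k *v axis last_ix 1))"
    using step.IH by blast
  obtain w where w: "srs_map r w = y" using surj by blast
  have "norm (?M (Suc m) *v real_vec w - ?M n *v real_vec z)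
      \<le> norm (?M (Suc m) *v real_vec w - ?M m *v real_vec y)
        + norm (?M m *v real_vec y - ?M n *v real_vec z)"
    using norm_triangle_ineq[of "?M (Suc m) *v real_vec w - ?M m *v real_vec y"
      "?M m *v real_vec y - ?M n *v real_vec z"] by simp
  also have "\<dots> \<le> (\<Sum>k=n..<Suc m. norm (?M k *v axis last_ix 1))"
    using norm_matrix_power_srs_map_diff[of r m w] y(2) step.hyps
    by (simp add: w del: matrix_power.simps)
  finally have "norm (?M (Suc m) *v real_vec w - ?M n *v real_vec z)
      \<le> (\<Sum>k=n..<Suc m. norm (?M k *v axis last_ix 1))" .
  moreover have "(srs_map r ^^ Suc m) w = x" using w y(1) by (simp add: funpow_swap1)
  ultimately show ?case by blast
qed

section \<open>Covering of the space by the tiles\<close>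

theorem proposition3p7:
  fixes r :: "real^'n::{finite,linorder}"
  assumes "r \<in> interior srs_D"
    and "r $ first_ix \<noteq> 0"
  shows "(\<Union>x. srs_tile r x) = UNIV"
proof -
  let ?M = "matrix_power (companion_matrix r)"
  let ?e = "\<lambda>k. norm (?M k *v axis last_ix 1)"
  note root = interior_srs_D_root_less_1[OF assms(1)]
  have "norm (coeff (companion_poly r) 0) \<le> norm (lead_coeff (companion_poly r))"
    by (rule norm_coeff_0_le) (use root in \<open>auto intro: less_imp_le\<close>)
  then have "\<bar>r $ first_ix\<bar> \<le> 1"
    by (simp add: degree_companion_poly(2) coeff_0_companion_poly)
  then have surj: "\<exists>y. srs_map r y = x" for x by (rule srs_map_surj[OF assms(2)])
  have summable: "summable (\<lambda>n. norm (?M n *v v))" for v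
    by (rule summable_companion_orbit) (rule root)
  then have M_null: "(\<lambda>n. ?M n *v v) \<longlonglongrightarrow> 0" for v
    by (rule tendsto_norm_zero_cancel[OF summable_LIMSEQ_zero])
  have "\<exists>x. t \<in> srs_tile r x" for t
  proof -
    have "\<exists>v. ?M n *v v = t" for n
      by (rule matrix_power_surj[OF companion_matrix_surj[OF assms(2)]])
    then obtain u where u: "\<And>n. ?M n *v u n = t" by metis
    define z where "z n = (\<chi> i. \<lfloor>u n $ i\<rfloor>)" for n
    \<comment> \<open>The rounding errors have coordinates of modulus at most 1, so M^n contracts
      them to 0.\<close>
    have "(\<lambda>n. ?M n *v (real_vec (z n) - u n)) \<longlonglongrightarrow> 0"
      by (rule matrix_power_mult_tendsto_0[OF M_null, of _ 1])
         (simp add: z_def real_vec_def, linarith)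
    then have lim: "(\<lambda>n. ?M n *v real_vec (z n)) \<longlonglongrightarrow> t"
      by (subst LIM_zero_iff[symmetric]) (simp add: matrix_vector_mult_diff_distrib u)
    then obtain B where B: "\<And>n. norm (?M n *v real_vec (z n)) \<le> B"
      using convergent_imp_Bseq[OF convergentI[OF lim]] unfolding Bseq_def by blast
    define X where "X n = (srs_map r ^^ n) (z n)" for n
    \<comment> \<open>This bound does not depend on \<open>n\<close>, so only finitely many integer
      vectors occur among the \<open>X n\<close>.\<close>
    have "norm (real_vec (X n)) \<le> B + suminf ?e" for n
    proof -
      have "sum ?e {..<n} \<le> suminf ?e" by (rule sum_le_suminf[OF summable]) auto
      then show ?thesis
        using norm_srs_orbit_le[of n r "z n"] B[of n] unfolding X_def by linarith
    qed
    then have "finite (range X)"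
      by (intro finite_subset[OF _ finite_real_vec_bounded[of "B + suminf ?e"]]) auto
    then obtain n0 where inf: "infinite {n. X n = X n0}"
      using pigeonhole_infinite[of UNIV X] by auto
    have "t \<in> srs_tile r (X n0)"
      unfolding srs_tile_def lower_limit_def
    proof (intro CollectI allI impI)
      fix U :: "(real^'n::{finite,linorder}) set" assume U: "open U" "t \<in> U"
      then obtain \<epsilon> where \<epsilon>: "\<epsilon> > 0" "ball t \<epsilon> \<subseteq> U" using open_contains_ball by metis
      then have half: "\<epsilon> / 2 > 0" by simp
      obtain N1 where N1: "\<And>n. n \<ge> N1 \<Longrightarrow> norm (?M n *v real_vec (z n) - t) < \<epsilon> / 2"
        using LIMSEQ_D[OF lim half] by blast
      obtain N2 where N2: "\<And>n m. n \<ge> N2 \<Longrightarrow> norm (sum ?e {n..<m}) < \<epsilon> / 2"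
        using summable[of "axis last_ix 1"] half unfolding summable_Cauchy by meson
      \<comment> \<open>The equality X n = X n0 is known only along a possibly sparse set, while the
        lower limit asks for all large m. One such \<open>n\<close> past both thresholds suffices:
        extending preimages from level \<open>n\<close> reaches every m \<ge> n at a cost below
        \<epsilon> / 2.\<close>
      obtain n where n: "n > max N1 N2" "X n = X n0"
        using inf unfolding infinite_nat_iff_unbounded by blast
      have "U \<inter> (\<lambda>z. ?M m *v real_vec z) ` srs_preimage r m (X n0) \<noteq> {}" if "m \<ge> n" for m
      proof -
        have "(srs_map r ^^ n) (z n) = X n0" using n(2) unfolding X_def .
        then have "\<exists>y. (srs_map r ^^ m) y = X n0 \<and>
            norm (?M m *v real_vec y - ?M n *v real_vec (z n)) \<le> sum ?e {n..<m}"
          using that by (rule srs_preimage_extend[rotated]) (rule surj)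
        then obtain y where y: "(srs_map r ^^ m) y = X n0"
          "norm (?M m *v real_vec y - ?M n *v real_vec (z n)) \<le> sum ?e {n..<m}"
          by blast
        have "sum ?e {n..<m} < \<epsilon> / 2" using N2[of n m] n(1) by simp
        moreover have "norm (?M n *v real_vec (z n) - t) < \<epsilon> / 2" using N1 n(1) by simp
        ultimately have "norm (?M m *v real_vec y - t) < \<epsilon>"
          using y(2) norm_triangle_ineq[of "?M m *v real_vec y - ?M n *v real_vec (z n)"
            "?M n *v real_vec (z n) - t"] by simp
        then have "?M m *v real_vec y \<in> U"
          using \<epsilon>(2) by (auto simp: dist_norm norm_minus_commute)
        then show ?thesis using y(1) by (auto simp: srs_preimage_def)
      qed
      then show "\<forall>\<^sub>F m in sequentially.
          U \<inter> (\<lambda>z. ?M m *v real_vec z) ` srs_preimage r m (X n0) \<noteq> {}"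
        by (auto simp: eventually_sequentially)
    qed
    then show ?thesis ..
  qed
  then show ?thesis by blast
qed

end
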